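(* Let $b\geq 2$ be an integer. Then: (1) There exists an oasis base $b$. (2) If $b$ is odd, then every $k$-oasis base $b$ has $k=1$. (3) If $b\geq 6$ is even, then there exists a $5$-oasis base $b$.
   Context: For integers $c\geq 0$ and $b\geq 2$, the augmented generalized happy function $S_{[c,b]}:\mathbb{Z}^+\to\mathbb{Z}^+$ is defined by $S_{[c,b]}\left(\sum_{i=0}^n a_i b^i\right)=c+\sum_{i=0}^n a_i^2$, where $0\le a_i\le b-1$, $a_n\neq 0$ (the base $b$ expansion). A positive integer $a$ is a fixed point of $S_{[c,b]}$ if $S_{[c,b]}(a)=a$. For $b\geq 2$ and $k\in\mathbb{Z}^+$, a $k$-oasis base $b$ is a set of $k$ consecutive non-negative integers $c$ such that for each of them $S_{[c,b]}$ has at least one fixed point; its length is $k$. An oasis base $b$ is a $k$-oasis base $b$ for some $k\geq 1$. *)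

theory Defs
  imports Main
begin

text \<open>
  The \<open>i\<close>-th base-\<open>b\<close> digit of \<open>a\<close> is \<open>a div b ^ i mod b\<close>. For \<open>b \<ge> 2\<close> and \<open>a > 0\<close> the indices \<open>i\<close>
  with \<open>b ^ i \<le> a\<close> form a finite set and are exactly the positions of the base-\<open>b\<close> expansion of \<open>a\<close>;
  the lemma \<open>happy_expansion\<close> below gives the value on an explicit expansion.
  For \<open>b < 2\<close> the definition carries no meaning.
\<close>

definition happy :: "nat \<Rightarrow> nat \<Rightarrow> nat \<Rightarrow> nat" where
  "happy c b a = c + (\<Sum>i | b ^ i \<le> a. (a div b ^ i mod b)\<^sup>2)"

text \<open>The domain of \<open>happy c b\<close> is the set of positive integers, so \<open>0\<close> never counts as a fixed point.\<close>

definition fixed_point :: "nat \<Rightarrow> nat \<Rightarrow> nat \<Rightarrow> bool" where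
  "fixed_point c b a \<longleftrightarrow> a > 0 \<and> happy c b a = a"

definition k_oasis :: "nat \<Rightarrow> nat \<Rightarrow> nat set \<Rightarrow> bool" where
  "k_oasis b k C \<longleftrightarrow> k \<ge> 1 \<and> (\<exists>m. C = {m..<m + k}) \<and> (\<forall>c\<in>C. \<exists>a. fixed_point c b a)"

definition oasis :: "nat \<Rightarrow> nat set \<Rightarrow> bool" where
  "oasis b C \<longleftrightarrow> (\<exists>k\<ge>1. k_oasis b k C)"

lemma expansion_less:
  fixes b :: nat and d :: "nat \<Rightarrow> nat"
  assumes "\<And>i. i < n \<Longrightarrow> d i < b"
  shows "(\<Sum>i<n. d i * b ^ i) < b ^ n"
  using assms
proof (induction n)
  case 0
  then show ?case by simp
next
  case (Suc n)
  have "(\<Sum>i<n. d i * b ^ i) < b ^ n" using Suc by simp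
  moreover have "Suc (d n) * b ^ n \<le> b * b ^ n"
    using Suc.prems[of n] by (intro mult_right_mono) auto
  ultimately show ?case by simp
qed

lemma expansion_digit:
  fixes b :: nat and d :: "nat \<Rightarrow> nat"
  assumes "\<And>i. i < n \<Longrightarrow> d i < b" and "j < n"
  shows "(\<Sum>i<n. d i * b ^ i) div b ^ j mod b = d j"
proof -
  have b: "b > 0" using assms by force
  have "(\<Sum>i<n. d i * b ^ i) = (\<Sum>i<Suc j. d i * b ^ i) + (\<Sum>i=Suc j..<n. d i * b ^ i)"
    using assms(2) by (subst sum.union_disjoint[symmetric]) (auto intro: sum.cong)
  also have "(\<Sum>i=Suc j..<n. d i * b ^ i) = b ^ Suc j * (\<Sum>i=Suc j..<n. d i * b ^ (i - Suc j))"
    unfolding sum_distrib_left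
    by (intro sum.cong) (auto simp: mult.left_commute simp flip: power_add power_Suc)
  finally obtain q where q: "(\<Sum>i<n. d i * b ^ i) = (\<Sum>i<j. d i * b ^ i) + b ^ j * (d j + b * q)"
    by (auto simp: algebra_simps)
  have "(\<Sum>i<j. d i * b ^ i) < b ^ j" using assms by (intro expansion_less) auto
  then show ?thesis using b assms by (simp add: q)
qed

lemma happy_expansion:
  fixes b c n :: nat and d :: "nat \<Rightarrow> nat"
  assumes "b \<ge> 2" and "\<And>i. i \<le> n \<Longrightarrow> d i \<le> b - 1" and "d n \<noteq> 0"
  shows "happy c b (\<Sum>i\<le>n. d i * b ^ i) = c + (\<Sum>i\<le>n. (d i)\<^sup>2)"
proof -
  define a where "a = (\<Sum>i<Suc n. d i * b ^ i)"
  have d: "d i < b" if "i < Suc n" for i using assms(1) assms(2)[of i] that by simp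
  have "a < b ^ Suc n" unfolding a_def using d by (rule expansion_less)
  have "b ^ n \<le> a"
  proof -
    have "b ^ n \<le> d n * b ^ n" using assms(3) mult_le_mono1[of 1 "d n" "b ^ n"] by simp
    then show ?thesis by (simp add: a_def trans_le_add2 del: mult_le_cancel2)
  qed
  have "b ^ i \<le> a \<longleftrightarrow> i \<le> n" for i
  proof (cases "i \<le> n")
    case True
    then have "b ^ i \<le> b ^ n" using assms(1) by (intro power_increasing) auto
    with \<open>b ^ n \<le> a\<close> True show ?thesis by linarith
  next
    case False
    then have "b ^ Suc n \<le> b ^ i" using assms(1) by (intro power_increasing) auto
    with \<open>a < b ^ Suc n\<close> False show ?thesis by linarith
  qed
  then have "happy c b a = c + (\<Sum>i\<le>n. (a div b ^ i mod b)\<^sup>2)"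
    by (simp add: happy_def atMost_def)
  also have "(\<Sum>i\<le>n. (a div b ^ i mod b)\<^sup>2) = (\<Sum>i\<le>n. (d i)\<^sup>2)"
    unfolding a_def using d by (intro sum.cong refl) (simp add: expansion_digit del: sum.lessThan_Suc)
  finally show ?thesis by (simp add: a_def lessThan_Suc_atMost del: sum.lessThan_Suc)
qed

end

theory Submission
  imports Defs
begin

text \<open>
  A number \<open>a\<close> with digits \<open>d i\<close> is fixed iff \<open>c = (\<Sum>i. d i * (b ^ i - d i))\<close> over the integers. If \<open>b\<close> is odd, every
  summand is even, so \<open>c\<close> is even and no two consecutive values of \<open>c\<close> occur. If \<open>b = 2 * h\<close>, the
  two-digit number with leading digit \<open>h - t\<close> and last digit \<open>u\<close> is fixed for \<open>c = h\<^sup>2 - t\<^sup>2 - u * (u - 1)\<close>;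
  taking \<open>t \<in> {0, 1, 2}\<close> and \<open>u \<in> {0, 2}\<close> yields all of \<open>h\<^sup>2 - 4, \<dots>, h\<^sup>2\<close>.
\<close>

text \<open>For odd \<open>b\<close>, the square of a digit \<open>d\<close> has the same parity as
  its contribution \<open>d * b ^ i\<close>.\<close>

lemma even_sum_digits_squared_iff:
  fixes a b :: nat
  assumes "odd b"
  shows "even (\<Sum>i<n. (a div b ^ i mod b)\<^sup>2) \<longleftrightarrow> even (a mod b ^ n)"
proof (induction n)
  case 0
  then show ?case by simp
next
  case (Suc n)
  have "a mod b ^ Suc n = b ^ n * (a div b ^ n mod b) + a mod b ^ n"
    by (metis mod_mult2_eq power_Suc2)
  with Suc assms show ?case by auto
qed

lemma even_happy_iff:
  assumes "odd b" "b \<ge> 2"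
  shows "even (happy c b a) \<longleftrightarrow> even (c + a)"
proof -
  have lt: "n < b ^ n" for n
    using assms(2) by (intro power_gt_expt) simp
  \<comment> \<open>As \<open>i < b ^ i\<close>, every digit position of \<open>a\<close> is below
    \<open>a\<close>; the added positions hold the digit 0.\<close>
  have "(\<Sum>i | b ^ i \<le> a. (a div b ^ i mod b)\<^sup>2) = (\<Sum>i<a. (a div b ^ i mod b)\<^sup>2)"
    using order.strict_trans2[OF lt] by (intro sum.mono_neutral_left) auto
  then show ?thesis
    using even_sum_digits_squared_iff[OF assms(1), of a a] lt[of a] by (simp add: happy_def)
qed

lemma even_if_fixed_point:
  assumes "odd b" "b \<ge> 2" "fixed_point c b a"
  shows "even c"
  using even_happy_iff[OF assms(1,2), of c a] assms(3) by (auto simp: fixed_point_def)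

lemma fixed_point_two_digits:
  assumes "b \<ge> 2" "v < b" "u < b" "v > 0" and eq: "c + u\<^sup>2 + v\<^sup>2 = u + v * b"
  shows "fixed_point c b (u + v * b)"
proof -
  have "(if i = 0 then u else v) \<le> b - 1" for i :: nat
    using assms(2,3) by auto
  then show ?thesis
    using happy_expansion[of b 1 "\<lambda>i. if i = 0 then u else v" c] assms
    by (simp add: fixed_point_def)
qed

lemma k_oasis_5:
  fixes h :: nat
  assumes "h \<ge> 3"
  shows "k_oasis (2 * h) 5 {h\<^sup>2 - 4..<h\<^sup>2 - 4 + 5}"
proof -
  obtain g where h: "h = g + 3" using assms by (metis add.commute le_Suc_ex)
  have fixed: "\<exists>a. fixed_point c (2 * h) a"
    if "t \<le> 2" "u \<le> 2" "c + u\<^sup>2 + t\<^sup>2 = h\<^sup>2 + u" for c t u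
  proof -
    define v where "v = h - t"
    have v: "h = v + t" "v > 0" using that(1) h by (auto simp: v_def)
    \<comment> \<open>This rests on \<open>v * (2 * h - v) = (h - t) * (h + t)\<close>.\<close>
    have "c + u\<^sup>2 + v\<^sup>2 = u + v * (2 * h)"
      using that(3) by (simp add: v power2_eq_square algebra_simps)
    then show ?thesis
      using fixed_point_two_digits[of "2 * h" v u c] v that h by auto
  qed
  have "\<exists>a. fixed_point c (2 * h) a" if "c \<in> {h\<^sup>2 - 4..<h\<^sup>2 - 4 + 5}" for c
  proof -
    \<comment> \<open>This keeps the natural subtraction \<open>h\<^sup>2 - 4\<close> from
      truncating.\<close>
    have "h\<^sup>2 \<ge> 4" by (simp add: h power2_eq_square algebra_simps)
    with that have "c + 4 = h\<^sup>2 \<or> c + 3 = h\<^sup>2 \<or> c + 2 = h\<^sup>2 \<or> c + 1 = h\<^sup>2 \<or> c = h\<^sup>2" by auto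
    then show ?thesis
      using fixed[of 2 0 c] fixed[of 1 2 c] fixed[of 0 2 c] fixed[of 1 0 c] fixed[of 0 0 c]
      by auto
  qed
  then show ?thesis unfolding k_oasis_def by auto
qed

theorem theorem3:
  fixes b :: nat
  assumes "b \<ge> 2"
  shows "(\<exists>C. oasis b C)
    \<and> (odd b \<longrightarrow> (\<forall>k C. k_oasis b k C \<longrightarrow> k = 1))
    \<and> (even b \<and> b \<ge> 6 \<longrightarrow> (\<exists>C. k_oasis b 5 C))"
proof (intro conjI impI allI)
  have "fixed_point 0 b 1"
    using happy_expansion[of b 0 "\<lambda>_. 1" 0] assms by (simp add: fixed_point_def)
  then have "k_oasis b 1 {0..<0 + 1}" unfolding k_oasis_def by auto
  then show "\<exists>C. oasis b C" unfolding oasis_def by blast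
next
  fix k C
  assume "odd b" and *: "k_oasis b k C"
  then obtain m where C: "C = {m..<m + k}" and k: "k \<ge> 1" by (auto simp: k_oasis_def)
  have "even c" if "c \<in> C" for c
    using * that even_if_fixed_point[OF \<open>odd b\<close> assms] by (auto simp: k_oasis_def)
  \<comment> \<open>For \<open>k \<ge> 2\<close> both \<open>m\<close> and \<open>Suc m\<close>
    would lie in \<open>C\<close>, yet one of them is odd.\<close>
  from this[of m] this[of "Suc m"] show "k = 1" using k C by (cases "k = 1") auto
next
  assume "even b \<and> b \<ge> 6"
  then obtain h where "b = 2 * h" "h \<ge> 3" by auto
  then show "\<exists>C. k_oasis b 5 C" using k_oasis_5 by blast
qed

end
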